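(* For any basic game $G$ and information structure $S$, $$\mathcal{P}^{\mathit{MCE}}_{a\mid x,\varepsilon,\tau}(G,S)=\bigcup_{S^*\succsim_E S}\mathcal{P}^{\mathit{MPE}}_{a\mid x,\varepsilon,\tau}(G,S^* ).$$ That is, a decision rule $\sigma$ for $(G,S)$ is a Markov correlated equilibrium of $(G,S)$ if and only if there exist an expansion $S^*$ of $S$ and a Markov perfect equilibrium $\beta$ of $(G,S^* )$ such that $\beta$ induces $\sigma$.
   Context: **Games.** $\Delta(Y)$ is the set of probability distributions on a finite set $Y$. A basic game $G=\langle \mathcal{I},(\mathcal{A}_i,u_i)_{i\in\mathcal{I}},\mathcal{X},\mathcal{E},\psi,f,\delta\rangle$ consists of players $\mathcal{I}=\{1,\dots,I\}$, finite nonempty action sets $\mathcal{A}_i$ with $\mathcal{A}=\times_i\mathcal{A}_i$, a finite set $\mathcal{X}$ of public states, a finite set $\mathcal{E}$ of latent states, a prior $\psi_{\varepsilon\mid x}$ (for each $x$ a distribution on $\mathcal{E}$), transition probabilities $f_{x'\mid a,x,\varepsilon}$ (for each $(a,x,\varepsilon)$ a distribution on $\mathcal{X}$), flow payoffs $u_i:\mathcal{A}\times\mathcal{X}\times\mathcal{E}\to\mathbb{R}$, and a discount factor $\delta\in[0,1)$. An information structure $S=((\mathcal{T}_i)_{i\in\mathcal{I}},\pi)$ consists of finite nonempty signal sets $\mathcal{T}_i$, $\mathcal{T}=\times_i\mathcal{T}_i$, and $\pi:\mathcal{X}\times\mathcal{E}\to\Delta(\mathcal{T})$, written $\pi_{\tau\mid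 x,\varepsilon}$. **Play.** Time is $t=1,2,\dots$. In each period the public state $x$ is observed by all; $\varepsilon\sim\psi_{\cdot\mid x}$ is drawn (unobserved), then $\tau\sim\pi_{\cdot\mid x,\varepsilon}$; player $i$ observes $(x,\tau_i)$; players simultaneously choose actions; player $i$ receives $u_i(a,x,\varepsilon)$; the next public state is drawn from $f_{\cdot\mid a,x,\varepsilon}$. Players maximize expected discounted sums of flow payoffs. **Markov perfect equilibrium (MPE).** A Markov strategy of $i$ in $(G,S)$ is $\beta_i:\mathcal{X}\times\mathcal{T}_i\to\Delta(\mathcal{A}_i)$. A Markov strategy profile $\beta=(\beta_1,\dots,\beta_I)$ is an MPE of $(G,S)$ if it is a subgame perfect equilibrium: for every initial public state $x\in\mathcal{X}$ and every player $i$, no strategy of player $i$ (including history-dependent ones) gives $i$ a strictly higher expected discounted payoff from the beginning of a period with public state $x$ (before $\varepsilon$ and $\tau$ are drawn) than $\beta_i$ does, when the opponents use $\beta_{-i}$. **Markov correlated equilibrium (MCE).** A decision rule for $(G,S)$ is a map $\sigma:\mathcal{X}\times\mathcal{E}\times\mathcal{T}\to\Delta(\mathcal{A})$. Let $V_i^\sigma\in\mathbb{R}^{|\mathcal{X}|}$ be the unique solution of $$V_i^\sigma(x)=\sum_{\varepsilon,\tau,a}\psi_{\varepsilon\mid x}\pi_{\tau\mid x,\varepsilon}\sigma_{a\mid x,\varepsilon,\tau}\Big\{u_i(a,x,\varepsilon)+\delta\sum_{x'}V_i^\sigma(x')f_{x'\mid a,x,\varepsilon}\Big\}\quad\forall x,$$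 and $v_i^\sigma(a,x,\varepsilon)=u_i(a,x,\varepsilon)+\delta\sum_{x'}V_i^\sigma(x')f_{x'\mid a,x,\varepsilon}$. Then $\sigma$ is an MCE of $(G,S)$ if for all $i$, $x$, $\tau_i\in\mathcal{T}_i$, $a_i,a_i'\in\mathcal{A}_i$, $$\sum_{\varepsilon,\tau_{-i},a_{-i}}\psi_{\varepsilon\mid x}\pi_{\tau\mid x,\varepsilon}\sigma_{a\mid x,\varepsilon,\tau}v_i^\sigma(a,x,\varepsilon)\ge\sum_{\varepsilon,\tau_{-i},a_{-i}}\psi_{\varepsilon\mid x}\pi_{\tau\mid x,\varepsilon}\sigma_{a\mid x,\varepsilon,\tau}v_i^\sigma(a_i',a_{-i},x,\varepsilon).$$ **Expansion.** $S^*=((\mathcal{T}^*_i)_i,\pi^* )$ is an expansion of $S$, written $S^*\succsim_E S$, if there are finite nonempty sets $(\tilde{\mathcal{T}}_i)_{i}$ and $\lambda:\mathcal{X}\times\mathcal{E}\times\mathcal{T}\to\Delta(\tilde{\mathcal{T}})$, $\tilde{\mathcal{T}}=\times_i\tilde{\mathcal{T}}_i$, with $\mathcal{T}_i^*=\mathcal{T}_i\times\tilde{\mathcal{T}}_i$ and $\pi^*_{\tau,\tilde\tau\mid x,\varepsilon}=\pi_{\tau\mid x,\varepsilon}\lambda_{\tilde\tau\mid x,\varepsilon,\tau}$. A strategy profile $\beta$ in $(G,S^* )$ induces the decision rule $\sigma$ for $(G,S)$ if $\sigma_{a\mid x,\varepsilon,\tau}=\sum_{\tilde\tau}\lambda_{\tilde\tau\mid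 x,\varepsilon,\tau}\prod_{i}\beta_i(a_i\mid x,\tau_i,\tilde\tau_i)$ for all $a,x,\varepsilon,\tau$ (for the $\lambda$ associated with the expansion). **Predictions.** $\mathcal{P}^{\mathit{MCE}}_{a\mid x,\varepsilon,\tau}(G,S)$ is the set of MCE of $(G,S)$; $\mathcal{P}^{\mathit{MPE}}_{a\mid x,\varepsilon,\tau}(G,S^* )$, for $S^*\succsim_E S$, is the set of decision rules for $(G,S)$ (conditional distributions of $a$ given $(x,\varepsilon,\tau)$, with $\tau\in\mathcal{T}$ the $S$-signal profile) induced by MPE of $(G,S^* )$. *)

theory Defs
  imports "HOL-Probability.Probability" "HOL-Probability.Product_PMF" "HOL-Library.Infinite_Typeclass"
begin

text \<open>
  Players, public states and latent states are the elements of finite types. Action and signal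
  sets depend on the player, so they are families of finite subsets of a common type, and a
  profile is a function on players.
\<close>

record ('i, 'a, 'x, 'e) basic_game =
  actions :: "'i \<Rightarrow> 'a set"
  payoff :: "'i \<Rightarrow> ('i \<Rightarrow> 'a) \<Rightarrow> 'x \<Rightarrow> 'e \<Rightarrow> real"
  prior :: "'x \<Rightarrow> 'e pmf"
  transition :: "('i \<Rightarrow> 'a) \<Rightarrow> 'x \<Rightarrow> 'e \<Rightarrow> 'x pmf"
  discount :: real

record ('i, 't, 'x, 'e) info_structure =
  signals :: "'i \<Rightarrow> 't set"
  signal_dist :: "'x \<Rightarrow> 'e \<Rightarrow> ('i \<Rightarrow> 't) pmf"

definition profiles :: "('i \<Rightarrow> 'b set) \<Rightarrow> ('i \<Rightarrow> 'b) set" where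
  "profiles B = {b. \<forall>i. b i \<in> B i}"

definition is_basic_game :: "('i, 'a, 'x, 'e) basic_game \<Rightarrow> bool" where
  "is_basic_game G \<longleftrightarrow>
     (\<forall>i. finite (actions G i) \<and> actions G i \<noteq> {}) \<and> 0 \<le> discount G \<and> discount G < 1"

definition is_info_structure :: "('i, 't, 'x, 'e) info_structure \<Rightarrow> bool" where
  "is_info_structure S \<longleftrightarrow>
     (\<forall>i. finite (signals S i) \<and> signals S i \<noteq> {}) \<and>
     (\<forall>x e. set_pmf (signal_dist S x e) \<subseteq> profiles (signals S))"


section \<open>Play and Markov perfect equilibrium\<close>

type_synonym ('i, 'a, 'x, 't) markov_profile = "'i \<Rightarrow> 'x \<Rightarrow> 't \<Rightarrow> 'a pmf"

definition is_markov_profile ::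
    "('i, 'a, 'x, 'e) basic_game \<Rightarrow> ('i, 't, 'x, 'e) info_structure \<Rightarrow>
     ('i, 'a, 'x, 't) markov_profile \<Rightarrow> bool" where
  "is_markov_profile G S \<beta> \<longleftrightarrow>
     (\<forall>i x. \<forall>t \<in> signals S i. set_pmf (\<beta> i x t) \<subseteq> actions G i)"

text \<open>
  A strategy maps a player's past observations, the current public state and the player's current
  signal to a mixed action. For each past period, in chronological order, the observations are the
  public state, the player's own signal and the action profile that was played.
\<close>

type_synonym ('i, 'a, 'x, 't) strategy =
  "('x \<times> 't \<times> ('i \<Rightarrow> 'a)) list \<Rightarrow> 'x \<Rightarrow> 't \<Rightarrow> 'a pmf"

definition is_strategy ::
    "('i, 'a, 'x, 'e) basic_game \<Rightarrow> ('i, 't, 'x, 'e) info_structure \<Rightarrow> 'i \<Rightarrow>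
     ('i, 'a, 'x, 't) strategy \<Rightarrow> bool" where
  "is_strategy G S i s \<longleftrightarrow>
     (\<forall>h x. \<forall>t \<in> signals S i. set_pmf (s h x t) \<subseteq> actions G i)"

definition markov :: "('i, 'a, 'x, 't) markov_profile \<Rightarrow> 'i \<Rightarrow> ('i, 'a, 'x, 't) strategy" where
  "markov \<beta> = (\<lambda>i h x t. \<beta> i x t)"

type_synonym ('i, 'a, 'x, 'e, 't) period = "'x \<times> 'e \<times> ('i \<Rightarrow> 't) \<times> ('i \<Rightarrow> 'a)"

definition observed ::
    "'i \<Rightarrow> ('i, 'a, 'x, 'e, 't) period list \<Rightarrow> ('x \<times> 't \<times> ('i \<Rightarrow> 'a)) list" where
  "observed i h = map (\<lambda>(x, e, \<tau>, a). (x, \<tau> i, a)) h"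

text \<open>Given the signals and past observations, the players randomize independently.\<close>

definition stage ::
    "('i::finite, 'a, 'x, 'e) basic_game \<Rightarrow> ('i, 't, 'x, 'e) info_structure \<Rightarrow>
     ('i \<Rightarrow> ('i, 'a, 'x, 't) strategy) \<Rightarrow> ('i, 'a, 'x, 'e, 't) period list \<Rightarrow> 'x \<Rightarrow>
     ('i, 'a, 'x, 'e, 't) period pmf" where
  "stage G S s h x = do {
     e \<leftarrow> prior G x;
     \<tau> \<leftarrow> signal_dist S x e;
     a \<leftarrow> Pi_pmf UNIV undefined (\<lambda>i. s i (observed i h) x (\<tau> i));
     return_pmf (x, e, \<tau>, a)
   }"

text \<open>
  Joint distribution of the first \<open>n\<close> periods and of the public state that follows them, when play
  starts in public state \<open>x0\<close>.
\<close>

primrec play ::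
    "('i::finite, 'a, 'x, 'e) basic_game \<Rightarrow> ('i, 't, 'x, 'e) info_structure \<Rightarrow>
     ('i \<Rightarrow> ('i, 'a, 'x, 't) strategy) \<Rightarrow> 'x \<Rightarrow> nat \<Rightarrow>
     (('i, 'a, 'x, 'e, 't) period list \<times> 'x) pmf" where
  "play G S s x0 0 = return_pmf ([], x0)"
| "play G S s x0 (Suc n) = do {
     (h, x) \<leftarrow> play G S s x0 n;
     (_, e, \<tau>, a) \<leftarrow> stage G S s h x;
     x' \<leftarrow> transition G a x e;
     return_pmf (h @ [(x, e, \<tau>, a)], x')
   }"

definition expected_flow ::
    "('i::finite, 'a, 'x, 'e) basic_game \<Rightarrow> ('i, 't, 'x, 'e) info_structure \<Rightarrow>
     ('i \<Rightarrow> ('i, 'a, 'x, 't) strategy) \<Rightarrow> 'i \<Rightarrow> 'x \<Rightarrow> nat \<Rightarrow> real" where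
  "expected_flow G S s i x0 n =
     measure_pmf.expectation (play G S s x0 n \<bind> (\<lambda>(h, x). stage G S s h x))
       (\<lambda>(x, e, \<tau>, a). payoff G i a x e)"

text \<open>
  The expectation is taken period by period; flow payoffs are bounded, so this is the expectation
  of the discounted sum.
\<close>

definition discounted_payoff ::
    "('i::finite, 'a, 'x, 'e) basic_game \<Rightarrow> ('i, 't, 'x, 'e) info_structure \<Rightarrow>
     ('i \<Rightarrow> ('i, 'a, 'x, 't) strategy) \<Rightarrow> 'i \<Rightarrow> 'x \<Rightarrow> real" where
  "discounted_payoff G S s i x0 = (\<Sum>n. discount G ^ n * expected_flow G S s i x0 n)"

text \<open>
  Opponents' Markov strategies ignore the past, so the subgames are indexed by the public state at
  which they start.
\<close>

definition is_MPE ::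
    "('i::finite, 'a, 'x, 'e) basic_game \<Rightarrow> ('i, 't, 'x, 'e) info_structure \<Rightarrow>
     ('i, 'a, 'x, 't) markov_profile \<Rightarrow> bool" where
  "is_MPE G S \<beta> \<longleftrightarrow>
     is_markov_profile G S \<beta> \<and>
     (\<forall>x i s. is_strategy G S i s \<longrightarrow>
        discounted_payoff G S ((markov \<beta>)(i := s)) i x \<le> discounted_payoff G S (markov \<beta>) i x)"


section \<open>Markov correlated equilibrium\<close>

type_synonym ('i, 'a, 'x, 'e, 't) decision_rule =
  "'x \<Rightarrow> 'e \<Rightarrow> ('i \<Rightarrow> 't) \<Rightarrow> ('i \<Rightarrow> 'a) pmf"

definition is_decision_rule ::
    "('i, 'a, 'x, 'e) basic_game \<Rightarrow> ('i, 't, 'x, 'e) info_structure \<Rightarrow>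
     ('i, 'a, 'x, 'e, 't) decision_rule \<Rightarrow> bool" where
  "is_decision_rule G S \<sigma> \<longleftrightarrow>
     (\<forall>x e. \<forall>\<tau> \<in> profiles (signals S). set_pmf (\<sigma> x e \<tau>) \<subseteq> profiles (actions G))"

definition continuation ::
    "('i, 'a, 'x::finite, 'e) basic_game \<Rightarrow> 'i \<Rightarrow> ('x \<Rightarrow> real) \<Rightarrow> ('i \<Rightarrow> 'a) \<Rightarrow> 'x \<Rightarrow> 'e \<Rightarrow> real" where
  "continuation G i W a x e =
     payoff G i a x e + discount G * (\<Sum>x'\<in>UNIV. W x' * pmf (transition G a x e) x')"

definition value_of ::
    "('i, 'a, 'x::finite, 'e::finite) basic_game \<Rightarrow> ('i, 't, 'x, 'e) info_structure \<Rightarrow>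
     ('i, 'a, 'x, 'e, 't) decision_rule \<Rightarrow> 'i \<Rightarrow> 'x \<Rightarrow> real" where
  "value_of G S \<sigma> i = (THE V. \<forall>x. V x =
     (\<Sum>e\<in>UNIV. \<Sum>\<tau>\<in>profiles (signals S). \<Sum>a\<in>profiles (actions G).
        pmf (prior G x) e * pmf (signal_dist S x e) \<tau> * pmf (\<sigma> x e \<tau>) a * continuation G i V a x e))"

definition is_MCE ::
    "('i, 'a, 'x::finite, 'e::finite) basic_game \<Rightarrow> ('i, 't, 'x, 'e) info_structure \<Rightarrow>
     ('i, 'a, 'x, 'e, 't) decision_rule \<Rightarrow> bool" where
  "is_MCE G S \<sigma> \<longleftrightarrow>
     is_decision_rule G S \<sigma> \<and>
     (\<forall>i x. \<forall>t\<in>signals S i. \<forall>b\<in>actions G i. \<forall>b'\<in>actions G i.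
        (\<Sum>e\<in>UNIV. \<Sum>\<tau>\<in>{\<tau>\<in>profiles (signals S). \<tau> i = t}. \<Sum>a\<in>{a\<in>profiles (actions G). a i = b}.
           pmf (prior G x) e * pmf (signal_dist S x e) \<tau> * pmf (\<sigma> x e \<tau>) a
             * continuation G i (value_of G S \<sigma> i) a x e)
        \<ge>
        (\<Sum>e\<in>UNIV. \<Sum>\<tau>\<in>{\<tau>\<in>profiles (signals S). \<tau> i = t}. \<Sum>a\<in>{a\<in>profiles (actions G). a i = b}.
           pmf (prior G x) e * pmf (signal_dist S x e) \<tau> * pmf (\<sigma> x e \<tau>) a
             * continuation G i (value_of G S \<sigma> i) (a(i := b')) x e))"


section \<open>Expansions and predictions\<close>

text \<open>
  The additional signals are drawn from finite subsets \<open>Q i\<close> of a type \<open>'s\<close>. If \<open>'s\<close> is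
  infinite, every family of finite sets can be relabelled as such a family.
\<close>

type_synonym ('i, 'x, 'e, 't, 's) kernel = "'x \<Rightarrow> 'e \<Rightarrow> ('i \<Rightarrow> 't) \<Rightarrow> ('i \<Rightarrow> 's) pmf"

definition pair_profile :: "('i \<Rightarrow> 't) \<Rightarrow> ('i \<Rightarrow> 's) \<Rightarrow> 'i \<Rightarrow> 't \<times> 's" where
  "pair_profile \<tau> \<theta> = (\<lambda>i. (\<tau> i, \<theta> i))"

definition expansion_via ::
    "('i, 't, 'x, 'e) info_structure \<Rightarrow> ('i \<Rightarrow> 's set) \<Rightarrow> ('i, 'x, 'e, 't, 's) kernel \<Rightarrow>
     ('i, 't \<times> 's, 'x, 'e) info_structure \<Rightarrow> bool" where
  "expansion_via S Q \<Lambda> S' \<longleftrightarrow>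
     is_info_structure S' \<and>
     (\<forall>i. finite (Q i) \<and> Q i \<noteq> {}) \<and>
     (\<forall>x e. \<forall>\<tau>\<in>profiles (signals S). set_pmf (\<Lambda> x e \<tau>) \<subseteq> profiles Q) \<and>
     (\<forall>i. signals S' i = signals S i \<times> Q i) \<and>
     (\<forall>x e. \<forall>\<tau>\<in>profiles (signals S). \<forall>\<theta>\<in>profiles Q.
        pmf (signal_dist S' x e) (pair_profile \<tau> \<theta>) = pmf (signal_dist S x e) \<tau> * pmf (\<Lambda> x e \<tau>) \<theta>)"

definition expansion ::
    "('i, 't, 'x, 'e) info_structure \<Rightarrow> ('i, 't \<times> 's, 'x, 'e) info_structure \<Rightarrow> bool" where
  "expansion S S' \<longleftrightarrow> (\<exists>Q \<Lambda>. expansion_via S Q \<Lambda> S')"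

definition induces ::
    "('i::finite, 'a, 'x, 'e) basic_game \<Rightarrow> ('i, 't, 'x, 'e) info_structure \<Rightarrow>
     ('i \<Rightarrow> 's set) \<Rightarrow> ('i, 'x, 'e, 't, 's) kernel \<Rightarrow> ('i, 'a, 'x, 't \<times> 's) markov_profile \<Rightarrow>
     ('i, 'a, 'x, 'e, 't) decision_rule \<Rightarrow> bool" where
  "induces G S Q \<Lambda> \<beta> \<sigma> \<longleftrightarrow>
     (\<forall>x e. \<forall>\<tau>\<in>profiles (signals S). \<forall>a\<in>profiles (actions G).
        pmf (\<sigma> x e \<tau>) a =
          (\<Sum>\<theta>\<in>profiles Q. pmf (\<Lambda> x e \<tau>) \<theta> * (\<Prod>i\<in>UNIV. pmf (\<beta> i x (\<tau> i, \<theta> i)) (a i))))"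

definition MCE_predictions ::
    "('i, 'a, 'x::finite, 'e::finite) basic_game \<Rightarrow> ('i, 't, 'x, 'e) info_structure \<Rightarrow>
     ('i, 'a, 'x, 'e, 't) decision_rule set" where
  "MCE_predictions G S = {\<sigma>. is_MCE G S \<sigma>}"

text \<open>
  \<open>S'\<close> does not determine \<open>\<Lambda>\<close> at signal profiles of probability zero under \<open>S\<close>, and the induced
  rule depends on \<open>\<Lambda>\<close> there, so \<open>\<Lambda>\<close> ranges over all kernels that exhibit \<open>S'\<close> as an expansion.
  Neither set of predictions constrains a rule at profiles outside \<open>profiles (signals S)\<close>.
\<close>

definition MPE_predictions ::
    "('i::finite, 'a, 'x, 'e) basic_game \<Rightarrow> ('i, 't, 'x, 'e) info_structure \<Rightarrow>
     ('i, 't \<times> 's, 'x, 'e) info_structure \<Rightarrow> ('i, 'a, 'x, 'e, 't) decision_rule set" where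
  "MPE_predictions G S S' = {\<sigma>. is_decision_rule G S \<sigma> \<and>
     (\<exists>Q \<Lambda> \<beta>. expansion_via S Q \<Lambda> S' \<and> is_MPE G S' \<beta> \<and> induces G S Q \<Lambda> \<beta> \<sigma>)}"

end

theory Submission imports Defs begin

text \<open>
  The value of a decision rule is the unique fixed point \<open>W\<close> of its Bellman operator, and the rule
  induced by a Markov profile has the same joint law of latent state, signal and action as that
  profile, hence the same \<open>W\<close>. Discounted payoffs differ from \<open>W\<close> by the discounted sum of the
  one-period advantages over \<open>W\<close>.

  Given an MCE, let each player's additional signal be the recommended action. Obedience is then
  optimal in every one-period problem with continuation value \<open>W\<close>, so no strategy earns more than
  \<open>W\<close>. Conversely, if an MPE induced a rule violating the obedience constraint of player \<open>i\<close> at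
  \<open>(x, t, b, b')\<close>, then the stationary deviation that plays \<open>b'\<close> in place of \<open>b\<close> whenever the
  state is \<open>x\<close> and the original signal is \<open>t\<close> would have nonnegative advantage everywhere and a
  positive one at \<open>x\<close>, hence would be profitable from \<open>x\<close>.
\<close>

section \<open>Finite expectations and independent products\<close>

lemma expectation_bind_pmf_finite:
  fixes h :: "'b \<Rightarrow> real"
  assumes "finite (set_pmf p)" "\<And>x. x \<in> set_pmf p \<Longrightarrow> finite (set_pmf (f x))"
  shows "measure_pmf.expectation (p \<bind> f) h
    = measure_pmf.expectation p (\<lambda>x. measure_pmf.expectation (f x) h)"
  using assms
  by (subst pmf_expectation_bind[of "set_pmf p"], simp_all)
    (subst integral_measure_pmf[of "set_pmf p"], auto)

lemma expectation_pmf_cong: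
  fixes f g :: "'b \<Rightarrow> real"
  assumes "\<And>x. x \<in> set_pmf p \<Longrightarrow> f x = g x"
  shows "measure_pmf.expectation p f = measure_pmf.expectation p g"
  using assms by (intro integral_cong_AE) (auto simp: AE_measure_pmf_iff)

lemma expectation_pmf_abs_le:
  fixes f :: "'b \<Rightarrow> real"
  assumes "finite (set_pmf p)" "\<And>x. x \<in> set_pmf p \<Longrightarrow> \<bar>f x\<bar> \<le> B"
  shows "\<bar>measure_pmf.expectation p f\<bar> \<le> B"
proof -
  have "\<bar>measure_pmf.expectation p f\<bar> \<le> measure_pmf.expectation p (\<lambda>x. \<bar>f x\<bar>)"
    by simp
  also have "\<dots> \<le> measure_pmf.expectation p (\<lambda>x. B)"
    using assms by (intro integral_mono_AE) (auto simp: AE_measure_pmf_iff integrable_measure_pmf_finite)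
  finally show ?thesis by simp
qed

text \<open>The value \<open>c u v\<close> reveals \<open>u\<close>, so only one term of the mixture
  contributes. The coding \<open>c\<close> will be \<open>Pair\<close> for outcomes and
  \<open>pair_profile\<close> for expanded signals.\<close>

lemma pmf_bind_map_pair:
  fixes c :: "'a \<Rightarrow> 'b \<Rightarrow> 'c"
  assumes inj: "\<And>u v u' v'. c u v = c u' v' \<Longrightarrow> u = u' \<and> v = v'"
  shows "pmf (p \<bind> (\<lambda>u. map_pmf (c u) (q u))) (c u v) = pmf p u * pmf (q u) v"
proof -
  have "pmf (map_pmf (c u') (q u')) (c u v) = (if u' = u then pmf (q u) v else 0)" for u'
    using inj by (auto simp: pmf_map_inj' inj_on_def pmf_eq_0_set_pmf)
  then show ?thesis
    by (simp add: pmf_bind, subst integral_measure_pmf[of "{u}"]) (auto split: if_splits)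
qed

text \<open>With every other factor degenerate, the only randomness left is that of player
  \<open>i\<close>: a single deviator facing opponents who obey the recommendations
  \<open>a\<close>.\<close>

lemma Pi_pmf_update_return:
  fixes a :: "'i::finite \<Rightarrow> 'a"
  shows "Pi_pmf UNIV d ((\<lambda>j. return_pmf (a j))(i := p)) = map_pmf (\<lambda>c. a(i := c)) p"
proof -
  have rest: "Pi_pmf (- {i}) d ((\<lambda>j. return_pmf (a j))(i := p))
      = return_pmf (\<lambda>j. if j \<noteq> i then a j else d)"
    using Pi_pmf_cong[of "- {i}" "- {i}" d d "(\<lambda>j. return_pmf (a j))(i := p)" "\<lambda>j. return_pmf (a j)"]
    by simp
  have "Pi_pmf (insert i (- {i})) d ((\<lambda>j. return_pmf (a j))(i := p))
      = do {y \<leftarrow> p; return_pmf ((\<lambda>j. if j \<noteq> i then a j else d)(i := y))}"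
    by (subst Pi_pmf_insert') (simp_all add: rest bind_return_pmf)
  also have "\<dots> = map_pmf (\<lambda>c. a(i := c)) p"
    by (auto simp: map_pmf_def fun_eq_iff intro!: bind_pmf_cong)
  finally show ?thesis by (simp add: insert_UNIV Compl_eq_Diff_UNIV)
qed

text \<open>Relabelling one independent draw leaves the others untouched. A deviation that relabels
  a player's own action thus becomes a map applied to equilibrium play, which makes the two directly
  comparable.\<close>

lemma Pi_pmf_update_map:
  fixes \<mu> :: "'i::finite \<Rightarrow> 'a pmf"
  shows "Pi_pmf UNIV d (\<mu>(i := map_pmf g (\<mu> i))) = map_pmf (\<lambda>a. a(i := g (a i))) (Pi_pmf UNIV d \<mu>)"
proof -
  have "Pi_pmf UNIV d (\<mu>(i := map_pmf g (\<mu> i)))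
      = Pi_pmf UNIV d (\<lambda>j. \<mu> j \<bind> (\<lambda>v. return_pmf (if j = i then g v else v)))"
    by (rule Pi_pmf_cong) (auto simp: map_pmf_def bind_return_pmf')
  also have "\<dots> = map_pmf (\<lambda>a. a(i := g (a i))) (Pi_pmf UNIV d \<mu>)"
    by (subst Pi_pmf_bind[where d' = d])
      (auto simp: map_pmf_def fun_upd_def intro!: bind_pmf_cong arg_cong[of _ _ return_pmf])
  finally show ?thesis .
qed

section \<open>Discounted fixed points and discounted sums\<close>

text \<open>The identity minus \<open>\<delta>\<close> times \<open>P\<close> is a linear map on a
  finite-dimensional space; a maximum argument makes it injective, hence surjective.\<close>

lemma ex1_discounted_fixpoint:
  fixes P :: "'x::finite \<Rightarrow> 'x \<Rightarrow> real"
  assumes P: "\<And>x y. 0 \<le> P x y" "\<And>x. (\<Sum>y\<in>UNIV. P x y) = 1" and \<delta>: "0 \<le> \<delta>" "\<delta> < 1"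
  shows "\<exists>!V. \<forall>x. V x = r x + \<delta> * (\<Sum>y\<in>UNIV. P x y * V y)"
proof -
  \<comment> \<open>The homogeneous equation: where the absolute value of \<open>D\<close> attains
    its maximum \<open>M\<close>, averaging under \<open>P\<close> gives
    \<open>M \<le> \<delta> * M\<close>, and \<open>\<delta> < 1\<close> forces
    \<open>M \<le> 0\<close>. This serves both injectivity and uniqueness.\<close>
  have zero: "D = (\<lambda>_. 0)" if D: "\<And>x. D x = \<delta> * (\<Sum>y\<in>UNIV. P x y * D y)" for D :: "'x \<Rightarrow> real"
  proof -
    define M where "M = Max (range (\<lambda>x. \<bar>D x\<bar>))"
    have le: "\<bar>D x\<bar> \<le> M" for x by (simp add: M_def)
    have "M \<in> range (\<lambda>x. \<bar>D x\<bar>)" unfolding M_def by (rule Max_in) auto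
    then obtain x where x: "M = \<bar>D x\<bar>" by auto
    have "\<bar>\<Sum>y\<in>UNIV. P x y * D y\<bar> \<le> (\<Sum>y\<in>UNIV. P x y * M)"
      using P le by (intro order_trans[OF sum_abs] sum_mono) (simp add: abs_mult mult_left_mono)
    also have "\<dots> = M" by (simp only: P sum_distrib_right[symmetric] mult_1_left)
    finally have "\<delta> * \<bar>\<Sum>y\<in>UNIV. P x y * D y\<bar> \<le> \<delta> * M"
      using \<delta>(1) by (rule mult_left_mono)
    moreover have "M = \<delta> * \<bar>\<Sum>y\<in>UNIV. P x y * D y\<bar>"
      unfolding x D[of x] abs_mult using \<delta> by simp
    ultimately have "M \<le> \<delta> * M" by argo
    then have "(1 - \<delta>) * M \<le> 0" by (simp add: algebra_simps)
    then have "M \<le> 0" using \<delta> by (simp add: mult_le_0_iff)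
    then have "\<bar>D y\<bar> \<le> 0" for y using le[of y] by linarith
    then show ?thesis by (simp add: fun_eq_iff)
  qed
  \<comment> \<open>State functions become vectors so that injectivity of a linear endomorphism
    yields surjectivity.\<close>
  define f :: "real^'x \<Rightarrow> real^'x" where "f v = (\<chi> x. v $ x - \<delta> * (\<Sum>y\<in>UNIV. P x y * v $ y))" for v
  have lin: "linear f"
  proof (rule linearI)
    fix v w :: "real^'x" and c :: real
    show "f (v + w) = f v + f w"
      by (simp add: f_def vec_eq_iff distrib_left sum.distrib)
    have "(\<Sum>y\<in>UNIV. P x y * (c * v $ y)) = c * (\<Sum>y\<in>UNIV. P x y * v $ y)" for x
      by (simp add: sum_distrib_left mult.left_commute)
    then show "f (c *\<^sub>R v) = c *\<^sub>R f v"
      by (simp add: f_def vec_eq_iff right_diff_distrib)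
  qed
  have "v = 0" if "f v = 0" for v
  proof -
    have "v $ x - \<delta> * (\<Sum>y\<in>UNIV. P x y * v $ y) = 0" for x
      using arg_cong[OF that, of "\<lambda>w. w $ x"] by (simp only: f_def vec_lambda_beta zero_index)
    then have "(\<lambda>x. v $ x) = (\<lambda>_. 0)"
      unfolding right_minus_eq by (rule zero)
    then show ?thesis by (simp add: vec_eq_iff fun_eq_iff)
  qed
  then have "surj f"
    using linear_injective_imp_surjective[OF lin] linear_injective_0[OF lin] by auto
  then obtain v where fv: "f v = (\<chi> x. r x)" by (metis surjD)
  have "v $ x - \<delta> * (\<Sum>y\<in>UNIV. P x y * v $ y) = r x" for x
    using arg_cong[OF fv, of "\<lambda>w. w $ x"] by (simp only: f_def vec_lambda_beta)
  then have v: "v $ x = r x + \<delta> * (\<Sum>y\<in>UNIV. P x y * v $ y)" for x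
    by (metis diff_eq_eq)
  show ?thesis
  proof (rule ex1I[of _ "\<lambda>x. v $ x"])
    show "\<forall>x. v $ x = r x + \<delta> * (\<Sum>y\<in>UNIV. P x y * v $ y)" using v by blast
  next
    fix V assume V: "\<forall>x. V x = r x + \<delta> * (\<Sum>y\<in>UNIV. P x y * V y)"
    have "(\<lambda>x. V x - v $ x) = (\<lambda>_. 0)"
    proof (rule zero)
      fix x
      have "V x - v $ x
        = \<delta> * (\<Sum>y\<in>UNIV. P x y * V y) - \<delta> * (\<Sum>y\<in>UNIV. P x y * v $ y)"
        using V v[of x] by (metis add_diff_cancel_left)
      then show "V x - v $ x = \<delta> * (\<Sum>y\<in>UNIV. P x y * (V y - v $ y))"
        by (simp add: right_diff_distrib sum_subtractf)
    qed
    then show "V = (\<lambda>x. v $ x)" by (simp add: fun_eq_iff)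
  qed
qed

text \<open>The \<open>J\<close> terms are differences of consecutive values of
  \<open>\<delta> ^ n * J n\<close>. This sequence tends to zero because \<open>J\<close> is
  bounded, so the telescoping part contributes exactly \<open>- J 0\<close>.\<close>

lemma discounted_telescope:
  fixes F J :: "nat \<Rightarrow> real"
  assumes \<delta>: "0 \<le> \<delta>" "\<delta> < 1" and F: "\<And>n. \<bar>F n\<bar> \<le> B" and J: "\<And>n. \<bar>J n\<bar> \<le> C"
  shows "(\<lambda>n. \<delta> ^ n * (F n + \<delta> * J (Suc n) - J n)) sums ((\<Sum>n. \<delta> ^ n * F n) - J 0)"
proof -
  have bdd: "summable (\<lambda>n. \<delta> ^ n * H n)" if "\<And>n. \<bar>H n\<bar> \<le> K" for H :: "nat \<Rightarrow> real" and K
  proof (rule summable_comparison_test'[where g = "\<lambda>n. \<delta> ^ n * K" and N = 0])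
    show "summable (\<lambda>n. \<delta> ^ n * K)"
      using \<delta> by (intro summable_mult2 summable_geometric) simp
    show "norm (\<delta> ^ n * H n) \<le> \<delta> ^ n * K" for n
      using \<delta> that[of n] by (simp add: abs_mult mult_left_mono)
  qed
  have "(\<lambda>n. \<delta> ^ n * J n) \<longlonglongrightarrow> 0"
    using bdd[OF J] by (rule summable_LIMSEQ_zero)
  then have "(\<lambda>n. \<delta> ^ Suc n * J (Suc n) - \<delta> ^ n * J n) sums (0 - \<delta> ^ 0 * J 0)"
    by (rule telescope_sums)
  from sums_add[OF summable_sums[OF bdd[OF F]] this] show ?thesis
    by (simp add: algebra_simps)
qed


section \<open>One-period outcomes\<close>

lemma finite_profiles: "(\<And>i. finite (B i)) \<Longrightarrow> finite (profiles B :: ('i::finite \<Rightarrow> 'b) set)"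
  using finite_PiE[of UNIV B] by (simp add: profiles_def PiE_UNIV_domain Pi_def)

text \<open>Freezing the history turns a strategy profile into a decision rule, so that one period
  of play and a mediator's rule are handled by the same notion of outcome. The default
  \<open>undefined\<close> matches \<open>stage\<close>.\<close>

definition rule_after ::
    "('i::finite \<Rightarrow> ('i, 'a, 'x, 't) strategy) \<Rightarrow> ('i, 'a, 'x, 'e, 't) period list \<Rightarrow>
     ('i, 'a, 'x, 'e, 't) decision_rule" where
  "rule_after s h x e \<tau> = Pi_pmf UNIV undefined (\<lambda>i. s i (observed i h) x (\<tau> i))"

lemma rule_after_markov:
  "rule_after (markov \<beta>) h x e \<tau> = Pi_pmf UNIV undefined (\<lambda>i. \<beta> i x (\<tau> i))"
  by (simp add: rule_after_def markov_def)

text \<open>The sums over latent states, signals and actions in the definition of an MCE are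
  expectations under this law. As a \<open>pmf\<close> it can be pushed forward and compared across
  information structures.\<close>

definition outcome ::
    "('i, 'a, 'x, 'e) basic_game \<Rightarrow> ('i, 't, 'x, 'e) info_structure \<Rightarrow>
     ('i, 'a, 'x, 'e, 't) decision_rule \<Rightarrow> 'x \<Rightarrow> ('e \<times> ('i \<Rightarrow> 't) \<times> ('i \<Rightarrow> 'a)) pmf" where
  "outcome G S \<rho> x = do {
     e \<leftarrow> prior G x;
     \<tau> \<leftarrow> signal_dist S x e;
     a \<leftarrow> \<rho> x e \<tau>;
     return_pmf (e, \<tau>, a)
   }"

text \<open>This is the Bellman operator of \<open>\<rho>\<close> for player \<open>i\<close>,
  applied to the continuation value \<open>W\<close>.\<close>

definition expected_value ::
    "('i, 'a, 'x::finite, 'e) basic_game \<Rightarrow> ('i, 't, 'x, 'e) info_structure \<Rightarrow>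
     ('i, 'a, 'x, 'e, 't) decision_rule \<Rightarrow> 'i \<Rightarrow> ('x \<Rightarrow> real) \<Rightarrow> 'x \<Rightarrow> real" where
  "expected_value G S \<rho> i W x =
     measure_pmf.expectation (outcome G S \<rho> x) (\<lambda>(e, \<tau>, a). continuation G i W a x e)"

lemma stage_eq_outcome:
  "stage G S s h x = map_pmf (\<lambda>(e, \<tau>, a). (x, e, \<tau>, a)) (outcome G S (rule_after s h) x)"
  by (simp add: stage_def outcome_def rule_after_def map_bind_pmf)

lemma is_decision_rule_rule_after:
  assumes "\<And>i. is_strategy G S i (s i)"
  shows "is_decision_rule G S (rule_after s h)"
  using assms
  by (fastforce simp: is_decision_rule_def rule_after_def set_Pi_pmf PiE_dflt_def profiles_def
      is_strategy_def)

lemma is_strategy_markov: "is_markov_profile G S \<beta> \<Longrightarrow> is_strategy G S i (markov \<beta> i)"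
  by (simp add: is_markov_profile_def is_strategy_def markov_def)

locale finite_game =
  fixes G :: "('i::finite, 'a, 'x::finite, 'e::finite) basic_game"
    and S :: "('i, 't, 'x, 'e) info_structure"
  assumes game: "is_basic_game G" and info: "is_info_structure S"
begin

lemma finite_action_profiles: "finite (profiles (actions G))"
  and finite_signal_profiles: "finite (profiles (signals S))"
  using game info by (auto simp: is_basic_game_def is_info_structure_def intro!: finite_profiles)

lemma signal_support: "\<tau> \<in> set_pmf (signal_dist S x e) \<Longrightarrow> \<tau> \<in> profiles (signals S)"
  using info by (auto simp: is_info_structure_def)

lemma discount: "0 \<le> discount G" "discount G < 1"
  using game by (auto simp: is_basic_game_def)

lemma set_outcome:
  assumes "is_decision_rule G S \<rho>"
  shows "set_pmf (outcome G S \<rho> x) \<subseteq> UNIV \<times> profiles (signals S) \<times> profiles (actions G)"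
  using assms signal_support by (fastforce simp: outcome_def is_decision_rule_def)

lemma finite_outcome: "is_decision_rule G S \<rho> \<Longrightarrow> finite (set_pmf (outcome G S \<rho> x))"
  by (rule finite_subset[OF set_outcome])
    (auto simp: finite_action_profiles finite_signal_profiles)

lemma pmf_outcome:
  "pmf (outcome G S \<rho> x) (e, \<tau>, a) = pmf (prior G x) e * pmf (signal_dist S x e) \<tau> * pmf (\<rho> x e \<tau>) a"
proof -
  have *: "outcome G S \<rho> x = prior G x \<bind> (\<lambda>e. map_pmf (Pair e)
      (signal_dist S x e \<bind> (\<lambda>\<tau>. map_pmf (Pair \<tau>) (\<rho> x e \<tau>))))"
    by (simp add: outcome_def map_bind_pmf map_pmf_comp) (simp add: map_pmf_def)
  have pair: "pmf (p \<bind> (\<lambda>u. map_pmf (Pair u) (q u))) (u, v) = pmf p u * pmf (q u) v"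
    for p :: "'u pmf" and q :: "'u \<Rightarrow> 'v pmf" and u v
    by (rule pmf_bind_map_pair) simp
  show ?thesis by (simp only: * pair mult.assoc)
qed

lemma expectation_outcome:
  assumes "is_decision_rule G S \<rho>"
  shows "measure_pmf.expectation (outcome G S \<rho> x) f
    = (\<Sum>e\<in>UNIV. \<Sum>\<tau>\<in>profiles (signals S). \<Sum>a\<in>profiles (actions G).
        pmf (prior G x) e * pmf (signal_dist S x e) \<tau> * pmf (\<rho> x e \<tau>) a * f (e, \<tau>, a))"
  using set_outcome[OF assms]
  by (subst integral_measure_pmf[of "UNIV \<times> profiles (signals S) \<times> profiles (actions G)"])
    (auto simp: finite_action_profiles finite_signal_profiles sum.cartesian_product pmf_outcome
      intro!: sum.cong)

text \<open>Separating flow payoff from continuation exhibits the Bellman operator as a reward plus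
  \<open>discount G\<close> times a transition matrix averaged over outcomes.\<close>

lemma expected_value_affine:
  assumes "is_decision_rule G S \<rho>"
  shows "expected_value G S \<rho> i W x =
    measure_pmf.expectation (outcome G S \<rho> x) (\<lambda>(e, \<tau>, a). payoff G i a x e)
    + discount G * (\<Sum>y\<in>UNIV.
        measure_pmf.expectation (outcome G S \<rho> x) (\<lambda>(e, \<tau>, a). pmf (transition G a x e) y) * W y)"
proof -
  note integrable_measure_pmf_finite[OF finite_outcome[OF assms], simp]
  show ?thesis
    by (simp add: expected_value_def continuation_def case_prod_unfold mult.commute)
qed

section \<open>The value of a decision rule and the obedience constraints\<close>

lemma ex1_bellman:
  assumes \<rho>: "is_decision_rule G S \<rho>"
  shows "\<exists>!V. \<forall>x. V x = expected_value G S \<rho> i V x"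
  unfolding expected_value_affine[OF \<rho>]
proof (rule ex1_discounted_fixpoint)
  fix x
  \<comment> \<open>The averaged transition matrix is stochastic: exchange the finite sum with the
    expectation and use that each transition law has mass one.\<close>
  have "(\<Sum>y\<in>UNIV. measure_pmf.expectation (outcome G S \<rho> x) (\<lambda>(e, \<tau>, a). pmf (transition G a x e) y))
    = measure_pmf.expectation (outcome G S \<rho> x)
        (\<lambda>z. \<Sum>y\<in>UNIV. (\<lambda>(e, \<tau>, a). pmf (transition G a x e) y) z)"
    using finite_outcome[OF \<rho>, of x] by (simp add: integrable_measure_pmf_finite)
  also have "\<dots> = measure_pmf.expectation (outcome G S \<rho> x) (\<lambda>z. 1)"
    by (rule expectation_pmf_cong) (auto simp: sum_pmf_eq_1)
  finally show "(\<Sum>y\<in>UNIV. measure_pmf.expectation (outcome G S \<rho> x)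
      (\<lambda>(e, \<tau>, a). pmf (transition G a x e) y)) = 1" by simp
qed (auto simp: discount intro!: Bochner_Integration.integral_nonneg)

text \<open>Existence and uniqueness of the fixed point make the definite description in
  \<open>value_of\<close> denote it.\<close>

lemma value_of_bellman:
  assumes "is_decision_rule G S \<rho>"
  shows "value_of G S \<rho> i x = expected_value G S \<rho> i (value_of G S \<rho> i) x"
  using theI'[OF ex1_bellman[OF assms, of i]]
  by (simp add: value_of_def expected_value_def expectation_outcome[OF assms])

text \<open>Restricting the sums to own signal \<open>t\<close> and own action \<open>b\<close>
  amounts to inserting an indicator, so both sides of an obedience constraint are expectations under
  the same law.\<close>

lemma expectation_recommended:
  assumes \<rho>: "is_decision_rule G S \<rho>"
  shows "(\<Sum>e\<in>UNIV. \<Sum>\<tau>\<in>{\<tau>\<in>profiles (signals S). \<tau> i = t}. \<Sum>a\<in>{a\<in>profiles (actions G). a i = b}.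
      pmf (prior G x) e * pmf (signal_dist S x e) \<tau> * pmf (\<rho> x e \<tau>) a * f e \<tau> a)
    = measure_pmf.expectation (outcome G S \<rho> x)
        (\<lambda>(e, \<tau>, a). of_bool (\<tau> i = t \<and> a i = b) * f e \<tau> a)"
  unfolding expectation_outcome[OF \<rho>] prod.case
    sum.inter_filter[OF finite_action_profiles] sum.inter_filter[OF finite_signal_profiles]
proof (rule sum.cong[OF refl], rule sum.cong[OF refl])
  fix e \<tau>
  let ?p = "\<lambda>a. pmf (prior G x) e * pmf (signal_dist S x e) \<tau> * pmf (\<rho> x e \<tau>) a"
  show "(if \<tau> i = t then \<Sum>a\<in>profiles (actions G). if a i = b then ?p a * f e \<tau> a else 0 else 0)
    = (\<Sum>a\<in>profiles (actions G). ?p a * (of_bool (\<tau> i = t \<and> a i = b) * f e \<tau> a))"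
    by (cases "\<tau> i = t") (auto intro!: sum.cong)
qed

text \<open>By linearity each constraint becomes a sign condition on one expected gain. Such
  conditions can be averaged with nonnegative weights, or refuted by a single positive gain.\<close>

lemma is_MCE_iff:
  "is_MCE G S \<rho> \<longleftrightarrow> is_decision_rule G S \<rho> \<and>
    (\<forall>i x. \<forall>t\<in>signals S i. \<forall>b\<in>actions G i. \<forall>b'\<in>actions G i.
      measure_pmf.expectation (outcome G S \<rho> x) (\<lambda>(e, \<tau>, a). of_bool (\<tau> i = t \<and> a i = b) *
        (continuation G i (value_of G S \<rho> i) (a(i := b')) x e
          - continuation G i (value_of G S \<rho> i) a x e)) \<le> 0)"
proof -
  have "(\<Sum>e\<in>UNIV. \<Sum>\<tau>\<in>{\<tau>\<in>profiles (signals S). \<tau> i = t}. \<Sum>a\<in>{a\<in>profiles (actions G). a i = b}.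
      pmf (prior G x) e * pmf (signal_dist S x e) \<tau> * pmf (\<rho> x e \<tau>) a * f a e)
    \<ge> (\<Sum>e\<in>UNIV. \<Sum>\<tau>\<in>{\<tau>\<in>profiles (signals S). \<tau> i = t}. \<Sum>a\<in>{a\<in>profiles (actions G). a i = b}.
      pmf (prior G x) e * pmf (signal_dist S x e) \<tau> * pmf (\<rho> x e \<tau>) a * g a e)
    \<longleftrightarrow> measure_pmf.expectation (outcome G S \<rho> x)
      (\<lambda>(e, \<tau>, a). of_bool (\<tau> i = t \<and> a i = b) * (g a e - f a e)) \<le> 0"
    if \<rho>: "is_decision_rule G S \<rho>" for x i t b and f g :: "('i \<Rightarrow> 'a) \<Rightarrow> 'e \<Rightarrow> real"
  proof -
    note [simp] = integrable_measure_pmf_finite[OF finite_outcome[OF \<rho>]]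
    have "measure_pmf.expectation (outcome G S \<rho> x)
        (\<lambda>z. of_bool (fst (snd z) i = t \<and> snd (snd z) i = b) * (g (snd (snd z)) (fst z) - f (snd (snd z)) (fst z)))
      = measure_pmf.expectation (outcome G S \<rho> x)
        (\<lambda>z. of_bool (fst (snd z) i = t \<and> snd (snd z) i = b) * g (snd (snd z)) (fst z))
      - measure_pmf.expectation (outcome G S \<rho> x)
        (\<lambda>z. of_bool (fst (snd z) i = t \<and> snd (snd z) i = b) * f (snd (snd z)) (fst z))"
      unfolding right_diff_distrib by (rule Bochner_Integration.integral_diff) simp_all
    then show ?thesis
      unfolding expectation_recommended[OF \<rho>, where f = "\<lambda>e \<tau> a. f a e"]
        expectation_recommended[OF \<rho>, where f = "\<lambda>e \<tau> a. g a e"]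
      by (simp only: case_prod_unfold) linarith
  qed
  note * = this
  show ?thesis
    unfolding is_MCE_def by (intro conj_cong refl all_cong1 ball_cong) (rule *)
qed

text \<open>A mixed reply \<open>p\<close> to signal and recommendation gains a combination of the
  gains from pure replacements of \<open>b\<close> by \<open>c\<close> at \<open>t\<close>. The
  weights \<open>pmf (p t b) c\<close> are nonnegative and obedience makes each gain
  nonpositive.\<close>

lemma obedient_deviation_le:
  assumes mce: "is_MCE G S \<sigma>"
    and p: "\<And>t b. t \<in> signals S i \<Longrightarrow> b \<in> actions G i \<Longrightarrow> set_pmf (p t b) \<subseteq> actions G i"
  shows "measure_pmf.expectation (outcome G S \<sigma> x)
      (\<lambda>(e, \<tau>, a). measure_pmf.expectation (p (\<tau> i) (a i))
        (\<lambda>c. continuation G i (value_of G S \<sigma> i) (a(i := c)) x e))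
    \<le> value_of G S \<sigma> i x"
proof -
  have \<sigma>: "is_decision_rule G S \<sigma>" using mce by (simp add: is_MCE_def)
  define K where "K a e = continuation G i (value_of G S \<sigma> i) a x e" for a e
  define gain where "gain t b c = (\<lambda>(e, \<tau>, a). of_bool (\<tau> i = t \<and> a i = b) * (K (a(i := c)) e - K a e))"
    for t :: 't and b c
  note [simp] = integrable_measure_pmf_finite[OF finite_outcome[OF \<sigma>]]
  have fin: "finite (actions G i)" "finite (signals S i)"
    using game info by (auto simp: is_basic_game_def is_info_structure_def)
  have gain: "measure_pmf.expectation (outcome G S \<sigma> x) (gain t b c) \<le> 0"
    if "t \<in> signals S i" "b \<in> actions G i" "c \<in> actions G i" for t b c
    using mce that by (simp add: is_MCE_iff gain_def K_def)
  have val: "value_of G S \<sigma> i x = measure_pmf.expectation (outcome G S \<sigma> x) (\<lambda>(e, \<tau>, a). K a e)"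
    using value_of_bellman[OF \<sigma>, of i x] by (simp only: expected_value_def K_def)
  have "measure_pmf.expectation (outcome G S \<sigma> x)
      (\<lambda>(e, \<tau>, a). measure_pmf.expectation (p (\<tau> i) (a i)) (\<lambda>c. K (a(i := c)) e)) - value_of G S \<sigma> i x
    = measure_pmf.expectation (outcome G S \<sigma> x)
      (\<lambda>z. (\<lambda>(e, \<tau>, a). measure_pmf.expectation (p (\<tau> i) (a i)) (\<lambda>c. K (a(i := c)) e)) z
        - (\<lambda>(e, \<tau>, a). K a e) z)"
    unfolding val by (rule Bochner_Integration.integral_diff[symmetric]) simp_all
  also have "\<dots> = measure_pmf.expectation (outcome G S \<sigma> x)
      (\<lambda>z. \<Sum>t\<in>signals S i. \<Sum>b\<in>actions G i. \<Sum>c\<in>actions G i. pmf (p t b) c * gain t b c z)"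
  proof (rule expectation_pmf_cong)
    fix z assume "z \<in> set_pmf (outcome G S \<sigma> x)"
    then obtain e \<tau> a where z: "z = (e, \<tau>, a)" and \<tau>: "\<tau> i \<in> signals S i" and a: "a i \<in> actions G i"
      using set_outcome[OF \<sigma>] by (cases z) (auto simp: profiles_def)
    have supp: "set_pmf (p (\<tau> i) (a i)) \<subseteq> actions G i" using p \<tau> a by blast
    define D where "D t b = (\<Sum>c\<in>actions G i. pmf (p t b) c * (K (a(i := c)) e - K a e))" for t b
    \<comment> \<open>For a fixed outcome the indicators inside \<open>gain\<close> keep only the
      summand of the realized signal \<open>\<tau> i\<close> and recommendation
      \<open>a i\<close>.\<close>
    have "(\<Sum>t\<in>signals S i. \<Sum>b\<in>actions G i. \<Sum>c\<in>actions G i. pmf (p t b) c * gain t b c z)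
      = (\<Sum>t\<in>signals S i. if \<tau> i = t then \<Sum>b\<in>actions G i. if a i = b then D t b else 0 else 0)"
      unfolding z gain_def D_def by (intro sum.cong refl) (auto intro!: sum.cong)
    also have "\<dots> = D (\<tau> i) (a i)" using \<tau> a fin by simp
    also have "\<dots> = measure_pmf.expectation (p (\<tau> i) (a i)) (\<lambda>c. K (a(i := c)) e - K a e)"
      unfolding D_def using supp fin by (subst integral_measure_pmf[of "actions G i"]) auto
    also have "\<dots> = measure_pmf.expectation (p (\<tau> i) (a i)) (\<lambda>c. K (a(i := c)) e) - K a e"
      using finite_subset[OF supp fin(1)] by (simp add: integrable_measure_pmf_finite)
    finally show "(\<lambda>(e, \<tau>, a). measure_pmf.expectation (p (\<tau> i) (a i)) (\<lambda>c. K (a(i := c)) e)) z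
        - (\<lambda>(e, \<tau>, a). K a e) z
      = (\<Sum>t\<in>signals S i. \<Sum>b\<in>actions G i. \<Sum>c\<in>actions G i. pmf (p t b) c * gain t b c z)"
      by (simp add: z)
  qed
  also have "\<dots> = (\<Sum>t\<in>signals S i. \<Sum>b\<in>actions G i. \<Sum>c\<in>actions G i.
      pmf (p t b) c * measure_pmf.expectation (outcome G S \<sigma> x) (gain t b c))"
    by simp
  also have "\<dots> \<le> 0"
    using gain by (intro sum_nonpos) (simp add: mult_nonneg_nonpos)
  finally show ?thesis by (simp add: K_def)
qed


section \<open>Repeated play\<close>

context
  fixes s :: "'i \<Rightarrow> ('i, 'a, 'x, 't) strategy"
  assumes strategies: "\<And>i. is_strategy G S i (s i)"
begin

lemma finite_stage: "finite (set_pmf (stage G S s h x))"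
  by (simp add: stage_eq_outcome finite_outcome is_decision_rule_rule_after strategies)

lemma finite_play: "finite (set_pmf (play G S s x0 n))"
  by (induction n) (auto simp: finite_stage split_beta)

definition expected_state_value :: "('x \<Rightarrow> real) \<Rightarrow> 'x \<Rightarrow> nat \<Rightarrow> real" where
  "expected_state_value W x0 n = measure_pmf.expectation (play G S s x0 n) (\<lambda>(h, x). W x)"

text \<open>Condition on the history and state reached after \<open>n\<close> periods. The flow with
  index \<open>n\<close> is earned in the period that starts there, and the state with index
  \<open>Suc n\<close> is the one that follows it, so together they form the continuation
  payoff.\<close>

lemma expected_state_value_Suc:
  "expected_flow G S s i x0 n + discount G * expected_state_value W x0 (Suc n)
   = measure_pmf.expectation (play G S s x0 n) (\<lambda>(h, x). expected_value G S (rule_after s h) i W x)"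
proof -
  note fin = finite_play finite_stage
  have flow: "expected_flow G S s i x0 n = measure_pmf.expectation (play G S s x0 n)
      (\<lambda>(h, x). measure_pmf.expectation (stage G S s h x) (\<lambda>(y, e, \<tau>, a). payoff G i a y e))"
    unfolding expected_flow_def
    by (subst expectation_bind_pmf_finite) (auto simp: fin case_prod_unfold)
  have "expected_state_value W x0 (Suc n) = measure_pmf.expectation (play G S s x0 n)
      (\<lambda>(h, x). measure_pmf.expectation (stage G S s h x)
        (\<lambda>(y, e, \<tau>, a). measure_pmf.expectation (transition G a x e) W))"
    unfolding expected_state_value_def play.simps case_prod_unfold
    by (simp add: expectation_bind_pmf_finite fin)
  moreover have "measure_pmf.expectation (transition G a x e) W
      = (\<Sum>y\<in>UNIV. W y * pmf (transition G a x e) y)" for a x e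
    by (simp add: integral_measure_pmf_real[of UNIV])
  ultimately have cont: "expected_state_value W x0 (Suc n) = measure_pmf.expectation (play G S s x0 n)
      (\<lambda>(h, x). measure_pmf.expectation (stage G S s h x)
        (\<lambda>(y, e, \<tau>, a). \<Sum>y\<in>UNIV. W y * pmf (transition G a x e) y))"
    by simp
  \<comment> \<open>\<open>stage\<close> copies its state argument into the first component, so the
    payoff at \<open>y\<close> and the transition at \<open>x\<close> refer to the same
    state.\<close>
  have val: "expected_value G S (rule_after s h) i W x
     = measure_pmf.expectation (stage G S s h x) (\<lambda>(y, e, \<tau>, a). payoff G i a y e)
     + discount G * measure_pmf.expectation (stage G S s h x)
        (\<lambda>(y, e, \<tau>, a). \<Sum>y\<in>UNIV. W y * pmf (transition G a x e) y)" for h x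
    using finite_outcome[OF is_decision_rule_rule_after[OF strategies], of h x]
    by (simp add: stage_eq_outcome expected_value_def continuation_def case_prod_unfold
        integrable_measure_pmf_finite)
  show ?thesis
    by (simp add: flow cont val case_prod_unfold integrable_measure_pmf_finite finite_play)
qed

lemma expected_flow_bounded: "\<exists>B. \<forall>n. \<bar>expected_flow G S s i x0 n\<bar> \<le> B"
proof -
  let ?R = "(UNIV :: 'x set) \<times> (UNIV :: 'e set) \<times> profiles (actions G)"
  \<comment> \<open>A crude bound uniform over periods: strategies keep play inside the finite set
    of admissible action profiles.\<close>
  define B where "B = (\<Sum>(x, e, a)\<in>?R. \<bar>payoff G i a x e\<bar>)"
  have B: "\<bar>payoff G i a x e\<bar> \<le> B" if "a \<in> profiles (actions G)" for x e a
    unfolding B_def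
    using member_le_sum[of "(x, e, a)" ?R "\<lambda>(x, e, a). \<bar>payoff G i a x e\<bar>"] that
    by (auto simp: finite_action_profiles)
  have "\<bar>expected_flow G S s i x0 n\<bar> \<le> B" for n
    unfolding expected_flow_def
  proof (rule expectation_pmf_abs_le)
    show "finite (set_pmf (play G S s x0 n \<bind> (\<lambda>(h, x). stage G S s h x)))"
      by (auto simp: finite_play finite_stage split_beta)
  next
    fix z assume "z \<in> set_pmf (play G S s x0 n \<bind> (\<lambda>(h, x). stage G S s h x))"
    then show "\<bar>case z of (x, e, \<tau>, a) \<Rightarrow> payoff G i a x e\<bar> \<le> B"
      using set_outcome[OF is_decision_rule_rule_after[OF strategies]]
      by (fastforce simp: stage_eq_outcome intro!: B)
  qed
  then show ?thesis by blast
qed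

text \<open>The performance difference identity. Through it, one-period comparisons against \<open>W\<close> decide
  comparisons with history-dependent strategies, without decomposing play at its first period.\<close>

lemma discounted_payoff_sums:
  "(\<lambda>n. discount G ^ n * measure_pmf.expectation (play G S s x0 n)
      (\<lambda>(h, x). expected_value G S (rule_after s h) i W x - W x))
   sums (discounted_payoff G S s i x0 - W x0)"
proof -
  obtain B where B: "\<And>n. \<bar>expected_flow G S s i x0 n\<bar> \<le> B"
    using expected_flow_bounded by blast
  have "\<bar>W x\<bar> \<le> (\<Sum>y\<in>UNIV. \<bar>W y\<bar>)" for x
    by (rule member_le_sum) auto
  then have J: "\<bar>expected_state_value W x0 n\<bar> \<le> (\<Sum>y\<in>UNIV. \<bar>W y\<bar>)" for n
    unfolding expected_state_value_def
    by (intro expectation_pmf_abs_le) (auto simp: finite_play)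
  \<comment> \<open>The expected advantage in each period has exactly the form summed by
    \<open>discounted_telescope\<close>, with \<open>expected_state_value\<close> as the telescoping
    sequence.\<close>
  have "measure_pmf.expectation (play G S s x0 n)
      (\<lambda>(h, x). expected_value G S (rule_after s h) i W x - W x)
    = expected_flow G S s i x0 n + discount G * expected_state_value W x0 (Suc n)
      - expected_state_value W x0 n" for n
    unfolding expected_state_value_Suc
    by (simp add: expected_state_value_def case_prod_unfold integrable_measure_pmf_finite finite_play)
  moreover have "expected_state_value W x0 0 = W x0" by (simp add: expected_state_value_def)
  ultimately show ?thesis
    using discounted_telescope[OF discount, of "expected_flow G S s i x0" B "expected_state_value W x0", OF B J] by (simp add: discounted_payoff_def)
qed

section \<open>From one-period advantages to discounted payoffs\<close>

lemma discounted_payoff_le: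
  assumes "\<And>h x. expected_value G S (rule_after s h) i W x \<le> W x"
  shows "discounted_payoff G S s i x0 \<le> W x0"
proof -
  have "discounted_payoff G S s i x0 - W x0 \<le> 0"
    using discounted_payoff_sums sums_zero
  proof (rule sums_le[rotated])
    fix n
    have "measure_pmf.expectation (play G S s x0 n)
      (\<lambda>(h, x). expected_value G S (rule_after s h) i W x - W x)
      \<le> measure_pmf.expectation (play G S s x0 n) (\<lambda>_. 0)"
      using assms by (intro integral_mono_AE) (auto simp: integrable_measure_pmf_finite finite_play)
    then show "discount G ^ n * measure_pmf.expectation (play G S s x0 n)
      (\<lambda>(h, x). expected_value G S (rule_after s h) i W x - W x) \<le> 0"
      using discount by (simp add: mult_le_0_iff)
  qed
  then show ?thesis by simp
qed

lemma discounted_payoff_eq: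
  assumes "\<And>h x. expected_value G S (rule_after s h) i W x = W x"
  shows "discounted_payoff G S s i x0 = W x0"
  using discounted_payoff_sums[of x0 i W] sums_unique2[OF discounted_payoff_sums[of x0 i W], of 0] by (simp add: assms case_prod_unfold)

text \<open>All terms of the advantage series are nonnegative, so one strictly positive term
  suffices.\<close>

lemma discounted_payoff_greater:
  assumes ge: "\<And>h x. W x \<le> expected_value G S (rule_after s h) i W x"
    and gt: "W x0 < expected_value G S (rule_after s []) i W x0"
  shows "W x0 < discounted_payoff G S s i x0"
proof -
  let ?d = "\<lambda>n. discount G ^ n * measure_pmf.expectation (play G S s x0 n)
      (\<lambda>(h, x). expected_value G S (rule_after s h) i W x - W x)"
  have "0 < suminf ?d"
  proof (rule suminf_pos2)
    show "summable ?d" using discounted_payoff_sums by (rule sums_summable)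
    show "0 \<le> ?d n" for n
      using discount ge by (auto intro!: mult_nonneg_nonneg Bochner_Integration.integral_nonneg)
    \<comment> \<open>The initial term has empty history, state \<open>x0\<close> and weight
      \<open>discount G ^ 0 = 1\<close>, so it is positive even when the discount factor is
      zero.\<close>
    show "0 < ?d 0" using gt by simp
  qed
  then show ?thesis using sums_unique[OF discounted_payoff_sums[of x0 i W]] by simp
qed

end

end


section \<open>Expansions\<close>

lemma inj_pair_profile: "pair_profile \<tau> \<theta> = pair_profile \<tau>' \<theta>' \<Longrightarrow> \<tau> = \<tau>' \<and> \<theta> = \<theta>'"
  by (auto simp: pair_profile_def fun_eq_iff)

lemma fst_pair_profile [simp]: "fst \<circ> pair_profile \<tau> \<theta> = \<tau>"
  by (simp add: pair_profile_def fun_eq_iff)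

text \<open>The product formula fixes the masses on the product signal sets. Both laws are supported
  there, so the formula determines the whole law: draw the original signals, then the additional
  ones.\<close>

lemma expansion_signal_dist:
  assumes S: "is_info_structure S" and exp: "expansion_via S Q \<Lambda> S'"
  shows "signal_dist S' x e = signal_dist S x e \<bind> (\<lambda>\<tau>. map_pmf (pair_profile \<tau>) (\<Lambda> x e \<tau>))"
    (is "_ = ?R")
proof (rule pmf_eqI)
  fix \<tau>' :: "'a \<Rightarrow> 'b \<times> 'e"
  have sig: "signals S' i = signals S i \<times> Q i" for i
    using exp by (simp add: expansion_via_def)
  show "pmf (signal_dist S' x e) \<tau>' = pmf ?R \<tau>'"
  proof (cases "\<tau>' \<in> profiles (signals S')")
    case True
    define \<tau> \<theta> where "\<tau> = fst \<circ> \<tau>'" and "\<theta> = snd \<circ> \<tau>'"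
    have \<tau>': "\<tau>' = pair_profile \<tau> \<theta>" by (simp add: pair_profile_def \<tau>_def \<theta>_def)
    have "\<tau> \<in> profiles (signals S)" "\<theta> \<in> profiles Q"
      using True by (auto simp: profiles_def sig \<tau>_def \<theta>_def mem_Times_iff)
    then show ?thesis
      using exp unfolding expansion_via_def \<tau>'
      by (subst pmf_bind_map_pair[where c = pair_profile, OF inj_pair_profile]) auto
  next
    case False
    have "\<tau>' \<notin> set_pmf ?R"
    proof
      assume "\<tau>' \<in> set_pmf ?R"
      then obtain \<tau> \<theta> where \<tau>: "\<tau> \<in> set_pmf (signal_dist S x e)" and \<theta>: "\<theta> \<in> set_pmf (\<Lambda> x e \<tau>)"
        and \<tau>': "\<tau>' = pair_profile \<tau> \<theta>"
        by auto
      have "\<tau> \<in> profiles (signals S)" using S \<tau> by (auto simp: is_info_structure_def)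
      moreover from this have "\<theta> \<in> profiles Q" using exp \<theta> unfolding expansion_via_def by blast
      ultimately have "\<tau>' \<in> profiles (signals S')"
        by (simp add: \<tau>' sig profiles_def pair_profile_def)
      with False show False by simp
    qed
    moreover have "\<tau>' \<notin> set_pmf (signal_dist S' x e)"
      using False exp by (auto simp: expansion_via_def is_info_structure_def)
    ultimately show ?thesis by (metis pmf_eq_0_set_pmf)
  qed
qed

text \<open>The pointwise formula is a mixture over additional signals of independent play. Both
  sides vanish off the admissible action profiles, so agreement on them is equality of laws. Any
  \<open>h\<close> will do, since Markov strategies ignore it.\<close>

lemma induces_iff:
  fixes G :: "('i::finite, 'a, 'x, 'e) basic_game"
  assumes exp: "expansion_via S Q \<Lambda> S'" and \<sigma>: "is_decision_rule G S \<sigma>" and \<beta>: "is_markov_profile G S' \<beta>"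
  shows "induces G S Q \<Lambda> \<beta> \<sigma> \<longleftrightarrow> (\<forall>x e. \<forall>\<tau>\<in>profiles (signals S).
    \<sigma> x e \<tau> = \<Lambda> x e \<tau> \<bind> (\<lambda>\<theta>. rule_after (markov \<beta>) h x e (pair_profile \<tau> \<theta>)))"
proof -
  have Q: "finite (profiles Q)" using exp by (auto simp: expansion_via_def intro!: finite_profiles)
  have "(\<forall>a\<in>profiles (actions G). pmf (\<sigma> x e \<tau>) a =
      (\<Sum>\<theta>\<in>profiles Q. pmf (\<Lambda> x e \<tau>) \<theta> * (\<Prod>i\<in>UNIV. pmf (\<beta> i x (\<tau> i, \<theta> i)) (a i))))
    \<longleftrightarrow> \<sigma> x e \<tau> = \<Lambda> x e \<tau> \<bind> (\<lambda>\<theta>. rule_after (markov \<beta>) h x e (pair_profile \<tau> \<theta>))" (is "_ \<longleftrightarrow> _ = ?R")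
    if \<tau>: "\<tau> \<in> profiles (signals S)" for x e \<tau>
  proof -
    have \<Lambda>: "set_pmf (\<Lambda> x e \<tau>) \<subseteq> profiles Q" using exp \<tau> by (auto simp: expansion_via_def)
    have "pair_profile \<tau> \<theta> \<in> profiles (signals S')" if "\<theta> \<in> profiles Q" for \<theta>
      using exp \<tau> that by (auto simp: expansion_via_def profiles_def pair_profile_def)
    then have "set_pmf (rule_after (markov \<beta>) h x e (pair_profile \<tau> \<theta>)) \<subseteq> profiles (actions G)"
      if "\<theta> \<in> profiles Q" for \<theta>
      using is_decision_rule_rule_after[OF is_strategy_markov[OF \<beta>], of h] that
      by (auto simp: is_decision_rule_def)
    then have R: "set_pmf ?R \<subseteq> profiles (actions G)" using \<Lambda> by auto
    have inside: "pmf ?R a = (\<Sum>\<theta>\<in>profiles Q. pmf (\<Lambda> x e \<tau>) \<theta> * (\<Prod>i\<in>UNIV. pmf (\<beta> i x (\<tau> i, \<theta> i)) (a i)))" for a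
      unfolding pmf_bind using Q \<Lambda>
      by (subst integral_measure_pmf[of "profiles Q"])
        (auto simp: rule_after_markov pmf_Pi pair_profile_def)
    have outside: "pmf (\<sigma> x e \<tau>) a = 0 \<and> pmf ?R a = 0" if "a \<notin> profiles (actions G)" for a
      using that \<tau> R \<sigma> unfolding is_decision_rule_def pmf_eq_0_set_pmf by blast
    have "(\<forall>a\<in>profiles (actions G). pmf (\<sigma> x e \<tau>) a = pmf ?R a) \<longleftrightarrow> \<sigma> x e \<tau> = ?R"
      using outside by (auto intro!: pmf_eqI)
    then show ?thesis by (simp only: inside)
  qed
  then show ?thesis unfolding induces_def by blast
qed

lemma outcome_expansion:
  assumes S: "is_info_structure S" and exp: "expansion_via S Q \<Lambda> S'"
  shows "outcome G S' \<rho> x = do {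
      e \<leftarrow> prior G x;
      \<tau> \<leftarrow> signal_dist S x e;
      \<theta> \<leftarrow> \<Lambda> x e \<tau>;
      a \<leftarrow> \<rho> x e (pair_profile \<tau> \<theta>);
      return_pmf (e, pair_profile \<tau> \<theta>, a)
    }"
  by (simp add: outcome_def expansion_signal_dist[OF S exp] bind_assoc_pmf bind_map_pmf)

text \<open>Forgetting the additional signals integrates out \<open>\<Lambda>\<close>, which turns
  \<open>\<rho>\<close> into \<open>\<sigma>\<close>. Continuation payoffs do not see signals, so
  one-period values agree in the two structures.\<close>

lemma outcome_induced:
  assumes S: "is_info_structure S" and exp: "expansion_via S Q \<Lambda> S'"
    and \<sigma>: "\<And>e \<tau>. \<tau> \<in> profiles (signals S) \<Longrightarrow> \<sigma> x e \<tau> = \<Lambda> x e \<tau> \<bind> (\<lambda>\<theta>. \<rho> x e (pair_profile \<tau> \<theta>))"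
  shows "map_pmf (\<lambda>(e, \<tau>', a). (e, fst \<circ> \<tau>', a)) (outcome G S' \<rho> x) = outcome G S \<sigma> x"
  unfolding outcome_expansion[OF S exp] outcome_def[of G S]
proof (simp add: map_bind_pmf, intro bind_pmf_cong refl)
  fix e \<tau> assume "\<tau> \<in> set_pmf (signal_dist S x e)"
  then have "\<tau> \<in> profiles (signals S)" using S by (auto simp: is_info_structure_def)
  then show "\<Lambda> x e \<tau> \<bind> (\<lambda>\<theta>. \<rho> x e (pair_profile \<tau> \<theta>) \<bind>
      (\<lambda>a. return_pmf (e, \<tau>, a)))
    = \<sigma> x e \<tau> \<bind> (\<lambda>a. return_pmf (e, \<tau>, a))"
    by (simp add: \<sigma> bind_assoc_pmf)
qed

section \<open>From equilibrium in an expansion to obedience\<close>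

lemma MPE_induces_MCE:
  fixes G :: "('i::finite, 'a, 'x::finite, 'e::finite) basic_game"
  assumes G: "is_basic_game G" and S: "is_info_structure S" and exp: "expansion_via S Q \<Lambda> S'"
    and mpe: "is_MPE G S' \<beta>" and ind: "induces G S Q \<Lambda> \<beta> \<sigma>" and \<sigma>: "is_decision_rule G S \<sigma>"
  shows "is_MCE G S \<sigma>"
proof -
  interpret finite_game G S using G S by unfold_locales
  interpret S': finite_game G S' using G exp by unfold_locales (auto simp: expansion_via_def)
  have \<beta>: "is_markov_profile G S' \<beta>" using mpe by (simp add: is_MPE_def)
  have out: "outcome G S \<sigma> x
      = map_pmf (\<lambda>(e, \<tau>', a). (e, fst \<circ> \<tau>', a)) (outcome G S' (rule_after (markov \<beta>) h) x)" for h x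
    by (rule outcome_induced[OF S exp, symmetric]) (use ind induces_iff[OF exp \<sigma> \<beta>] in blast)
  show ?thesis
    unfolding is_MCE_iff
  proof (intro conjI \<sigma> allI ballI)
    fix i x0 t b b' assume b': "b' \<in> actions G i"
    define W where "W = value_of G S \<sigma> i"
    define K where "K a x e = continuation G i W a x e" for a x e
    define gain where "gain = measure_pmf.expectation (outcome G S \<sigma> x0)
      (\<lambda>(e, \<tau>, a). of_bool (\<tau> i = t \<and> a i = b) * (K (a(i := b')) x0 e - K a x0 e))"
    have W: "W x = measure_pmf.expectation (outcome G S \<sigma> x) (\<lambda>(e, \<tau>, a). K a x e)" for x
      unfolding W_def K_def by (subst value_of_bellman[OF \<sigma>]) (simp add: expected_value_def)
    \<comment> \<open>Equilibrium play has zero advantage over the value of the induced rule, so its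
      discounted payoff is that value.\<close>
    have "expected_value G S' (rule_after (markov \<beta>) h) i W x = W x" for h x
      using W[of x] unfolding out[of x h] by (simp add: expected_value_def K_def case_prod_unfold)
    then have conform: "discounted_payoff G S' (markov \<beta>) i x0 = W x0"
      using is_strategy_markov[OF \<beta>] by (intro S'.discounted_payoff_eq)
    define swap where "swap c = (if c = b then b' else c)" for c
    \<comment> \<open>The deviator draws from the equilibrium mixed action and then swaps
      \<open>b\<close> for \<open>b'\<close>. The swap depends only on the state and the original
      signal, matching an obedience constraint in which the additional signal is averaged
      out.\<close>
    define s :: "('i, 'a, 'x, 'b \<times> 'c) strategy" where
      "s h x t' = (if x = x0 \<and> fst t' = t then map_pmf swap (\<beta> i x t') else \<beta> i x t')" for h x t'
    have s: "is_strategy G S' i s"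
      using \<beta> b' by (fastforce simp: is_strategy_def s_def is_markov_profile_def swap_def)
    have rule: "rule_after ((markov \<beta>)(i := s)) h x e \<tau>' =
      map_pmf (\<lambda>a. if x = x0 \<and> fst (\<tau>' i) = t then a(i := swap (a i)) else a)
        (rule_after (markov \<beta>) h x e \<tau>')" for h x e \<tau>'
    proof -
      have "(\<lambda>j. ((markov \<beta>)(i := s)) j (observed j h) x (\<tau>' j))
        = (\<lambda>j. \<beta> j x (\<tau>' j))(i := s (observed i h) x (\<tau>' i))"
        by (auto simp: markov_def fun_eq_iff)
      then show ?thesis
        using Pi_pmf_update_map[of undefined "\<lambda>j. \<beta> j x (\<tau>' j)" i swap]
        by (auto simp: rule_after_def markov_def s_def fun_upd_idem)
    qed
    have "outcome G S' (rule_after ((markov \<beta>)(i := s)) h) x =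
      map_pmf (\<lambda>(e, \<tau>', a). (e, \<tau>', if x = x0 \<and> fst (\<tau>' i) = t then a(i := swap (a i)) else a))
        (outcome G S' (rule_after (markov \<beta>) h) x)" for h x
      by (simp add: outcome_def rule map_bind_pmf bind_map_pmf)
    then have "expected_value G S' (rule_after ((markov \<beta>)(i := s)) h) i W x
      = measure_pmf.expectation (outcome G S \<sigma> x)
        (\<lambda>(e, \<tau>, a). K (if x = x0 \<and> \<tau> i = t then a(i := swap (a i)) else a) x e)" for h x
      unfolding out[of x h] by (simp add: expected_value_def K_def case_prod_unfold cong: if_cong)
    \<comment> \<open>Unless the own action is \<open>b\<close>, the swap leaves the profile
      unchanged, so the payoff difference is precisely the integrand of \<open>gain\<close>.\<close>
    moreover have "(\<lambda>(e, \<tau>, a). K (if x = x0 \<and> \<tau> i = t then a(i := swap (a i)) else a) x e)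
      = (\<lambda>z. (\<lambda>(e, \<tau>, a). K a x e) z + of_bool (x = x0) *
        (\<lambda>(e, \<tau>, a). of_bool (\<tau> i = t \<and> a i = b) * (K (a(i := b')) x e - K a x e)) z)" for x
      by (auto simp: fun_eq_iff swap_def)
    \<comment> \<open>The advantage of the deviation is \<open>gain\<close> at \<open>x0\<close> and
      zero in every other state, after every history.\<close>
    ultimately have dev: "expected_value G S' (rule_after ((markov \<beta>)(i := s)) h) i W x
      = W x + of_bool (x = x0) * gain" for h x
      by (cases "x = x0") (simp_all add: W gain_def integrable_measure_pmf_finite finite_outcome \<sigma>)
    have strategies: "is_strategy G S' j (((markov \<beta>)(i := s)) j)" for j
      using s is_strategy_markov[OF \<beta>] by simp
    have "gain \<le> 0"
    proof (rule ccontr)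
      assume "\<not> gain \<le> 0"
      then have "W x0 < discounted_payoff G S' ((markov \<beta>)(i := s)) i x0"
        by (intro S'.discounted_payoff_greater strategies) (simp_all only: dev, auto)
      moreover have "discounted_payoff G S' ((markov \<beta>)(i := s)) i x0 \<le> discounted_payoff G S' (markov \<beta>) i x0"
        using mpe s by (simp add: is_MPE_def)
      ultimately show False using conform by simp
    qed
    then show "measure_pmf.expectation (outcome G S \<sigma> x0) (\<lambda>(e, \<tau>, a). of_bool (\<tau> i = t \<and> a i = b) *
        (continuation G i (value_of G S \<sigma> i) (a(i := b')) x0 e
          - continuation G i (value_of G S \<sigma> i) a x0 e)) \<le> 0"
      by (simp add: gain_def K_def W_def)
  qed
qed

section \<open>From obedience to equilibrium in an expansion\<close>

lemma MCE_induced_by_MPE: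
  fixes G :: "('i::finite, 'a, 'x::finite, 'e::finite) basic_game" and S :: "('i, 't, 'x, 'e) info_structure"
  assumes G: "is_basic_game G" and S: "is_info_structure S" and mce: "is_MCE G S \<sigma>"
  shows "\<exists>(S' :: ('i, 't \<times> 's::infinite, 'x, 'e) info_structure) Q \<Lambda> \<beta>.
    expansion_via S Q \<Lambda> S' \<and> is_MPE G S' \<beta> \<and> induces G S Q \<Lambda> \<beta> \<sigma>"
proof -
  interpret finite_game G S using G S by unfold_locales
  have \<sigma>: "is_decision_rule G S \<sigma>" using mce by (simp add: is_MCE_def)
  have fin: "finite (\<Union>i. actions G i)" using G by (auto simp: is_basic_game_def)
  \<comment> \<open>Recommendations are actions encoded in \<open>'s\<close>; an injective code
    exists because the actions of all players form a finite set and \<open>'s\<close> is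
    infinite.\<close>
  then obtain g :: "'a \<Rightarrow> 's" where g: "inj_on g (\<Union>i. actions G i)"
    using arb_inj_on_finite_infinite by blast
  define rec where "rec i u = inv_into (actions G i) g u" for i u
  have rec: "rec i (g b) = b" if "b \<in> actions G i" for i b
    unfolding rec_def using g that by (intro inv_into_f_f inj_on_subset[OF g]) auto
  define Q where "Q i = g ` actions G i" for i
  \<comment> \<open>The mediator draws a whole action profile from \<open>\<sigma>\<close> and sends
    each player the code of that player's own component; correlation among actions is carried by the
    signals.\<close>
  define \<Lambda> where "\<Lambda> x e \<tau> = map_pmf ((\<circ>) g) (\<sigma> x e \<tau>)" for x e \<tau>
  define S' where "S' = \<lparr>signals = (\<lambda>i. signals S i \<times> Q i),
    signal_dist = (\<lambda>x e. signal_dist S x e \<bind> (\<lambda>\<tau>. map_pmf (pair_profile \<tau>) (\<Lambda> x e \<tau>)))\<rparr>"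
  define \<beta> :: "('i, 'a, 'x, 't \<times> 's) markov_profile" where "\<beta> i x t' = return_pmf (rec i (snd t'))" for i x t'
  have \<Lambda>: "set_pmf (\<Lambda> x e \<tau>) \<subseteq> profiles Q" if "\<tau> \<in> profiles (signals S)" for x e \<tau>
    using \<sigma> that by (fastforce simp: \<Lambda>_def Q_def is_decision_rule_def profiles_def)
  have exp: "expansion_via S Q \<Lambda> S'"
    unfolding expansion_via_def
  proof (intro conjI allI ballI)
    show "is_info_structure S'"
      unfolding is_info_structure_def
    proof (intro conjI allI subsetI)
      show "finite (signals S' i)" "signals S' i \<noteq> {}" for i
        using G S by (auto simp: is_info_structure_def is_basic_game_def S'_def Q_def)
      fix x e \<tau>' assume "\<tau>' \<in> set_pmf (signal_dist S' x e)"
      then obtain \<tau> \<theta> where \<tau>: "\<tau> \<in> set_pmf (signal_dist S x e)" and \<theta>: "\<theta> \<in> set_pmf (\<Lambda> x e \<tau>)"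
        and \<tau>': "\<tau>' = pair_profile \<tau> \<theta>"
        by (auto simp: S'_def)
      have "\<tau> \<in> profiles (signals S)" using \<tau> by (rule signal_support)
      moreover from this have "\<theta> \<in> profiles Q" using \<Lambda> \<theta> by blast
      ultimately show "\<tau>' \<in> profiles (signals S')"
        by (simp add: \<tau>' profiles_def pair_profile_def S'_def)
    qed
    show "finite (Q i)" "Q i \<noteq> {}" for i using G by (auto simp: Q_def is_basic_game_def)
    show "pmf (signal_dist S' x e) (pair_profile \<tau> \<theta>) = pmf (signal_dist S x e) \<tau> * pmf (\<Lambda> x e \<tau>) \<theta>" for x e \<tau> \<theta>
      by (simp add: S'_def pmf_bind_map_pair[where c = pair_profile, OF inj_pair_profile])
  qed (use \<Lambda> in \<open>auto simp: S'_def\<close>)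
  then interpret S': finite_game G S' using G by unfold_locales (auto simp: expansion_via_def)
  have \<beta>: "is_markov_profile G S' \<beta>"
    by (auto simp: is_markov_profile_def S'_def Q_def \<beta>_def rec)
  have supp: "a i \<in> actions G i" if "a \<in> set_pmf (\<sigma> x e \<tau>)" "\<tau> \<in> profiles (signals S)" for a x e \<tau> i
  proof -
    have "a \<in> profiles (actions G)" using that \<sigma> unfolding is_decision_rule_def by blast
    then show ?thesis by (simp add: profiles_def)
  qed
  \<comment> \<open>Decoding undoes \<open>g\<close> on admissible actions, so obedient play returns
    the profile drawn from \<open>\<sigma>\<close>.\<close>
  have obey: "\<sigma> x e \<tau> = \<Lambda> x e \<tau> \<bind> (\<lambda>\<theta>. rule_after (markov \<beta>) h x e (pair_profile \<tau> \<theta>))"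
    if \<tau>: "\<tau> \<in> profiles (signals S)" for x e \<tau> h
  proof -
    have "\<Lambda> x e \<tau> \<bind> (\<lambda>\<theta>. rule_after (markov \<beta>) h x e (pair_profile \<tau> \<theta>))
      = \<sigma> x e \<tau> \<bind> (\<lambda>a. return_pmf (\<lambda>i. rec i (g (a i))))"
      by (simp add: \<Lambda>_def bind_map_pmf rule_after_markov \<beta>_def pair_profile_def)
    also have "\<dots> = \<sigma> x e \<tau> \<bind> return_pmf"
      by (intro bind_pmf_cong refl arg_cong[of _ _ return_pmf] ext) (simp add: rec supp[OF _ \<tau>])
    finally show ?thesis by (simp add: bind_return_pmf')
  qed
  have "induces G S Q \<Lambda> \<beta> \<sigma>"
    unfolding induces_iff[OF exp \<sigma> \<beta>, of "[]"] using obey by blast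
  moreover have "is_MPE G S' \<beta>"
    unfolding is_MPE_def
  proof (intro conjI \<beta> allI impI)
    fix x0 i s assume s: "is_strategy G S' i s"
    have strategies: "is_strategy G S' j (((markov \<beta>)(i := s)) j)" for j
      using s is_strategy_markov[OF \<beta>] by simp
    define W where "W = value_of G S \<sigma> i"
    have "expected_value G S' (rule_after (markov \<beta>) h) i W x = W x" for h x
    proof -
      have "W x = expected_value G S \<sigma> i W x"
        unfolding W_def by (rule value_of_bellman[OF \<sigma>])
      also have "\<dots> = expected_value G S' (rule_after (markov \<beta>) h) i W x"
        by (simp add: expected_value_def case_prod_unfold
            flip: outcome_induced[where \<rho> = "rule_after (markov \<beta>) h", OF S exp obey])
      finally show ?thesis ..
    qed
    then have "discounted_payoff G S' (markov \<beta>) i x0 = W x0"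
      using is_strategy_markov[OF \<beta>] by (intro S'.discounted_payoff_eq)
    moreover have "expected_value G S' (rule_after ((markov \<beta>)(i := s)) h) i W x \<le> W x" for h x
    proof -
      \<comment> \<open>After a fixed history, a strategy in the expanded game is just a mixed reply
        to original signal and recommendation.\<close>
      define p where "p t b = s (observed i h) x (t, g b)" for t b
      have p: "set_pmf (p t b) \<subseteq> actions G i" if "t \<in> signals S i" "b \<in> actions G i" for t b
        using s that by (auto simp: p_def is_strategy_def S'_def Q_def)
      have rule: "rule_after ((markov \<beta>)(i := s)) h x e (pair_profile \<tau> (g \<circ> a))
        = map_pmf (\<lambda>c. a(i := c)) (p (\<tau> i) (a i))"
        if "a \<in> set_pmf (\<sigma> x e \<tau>)" "\<tau> \<in> profiles (signals S)" for e \<tau> a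
      proof -
        have "(\<lambda>j. ((markov \<beta>)(i := s)) j (observed j h) x (pair_profile \<tau> (g \<circ> a) j))
          = (\<lambda>j. return_pmf (a j))(i := p (\<tau> i) (a i))"
          by (auto simp: fun_eq_iff markov_def \<beta>_def pair_profile_def p_def rec supp[OF that])
        then show ?thesis by (simp only: rule_after_def Pi_pmf_update_return)
      qed
      \<comment> \<open>Continuation payoffs depend only on latent state and actions, so signals are
        dropped. What remains is the law of obedient play with coordinate \<open>i\<close> redrawn
        from \<open>p\<close>.\<close>
      have played: "map_pmf (\<lambda>(e, \<tau>', a). (e, a)) (outcome G S' (rule_after ((markov \<beta>)(i := s)) h) x)
        = outcome G S \<sigma> x \<bind> (\<lambda>(e, \<tau>, a). map_pmf (\<lambda>c. (e, a(i := c))) (p (\<tau> i) (a i)))"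
        unfolding outcome_expansion[OF S exp] outcome_def[of G S] \<Lambda>_def
        by (auto simp: map_bind_pmf bind_map_pmf bind_assoc_pmf bind_return_pmf rule signal_support
            map_pmf_def[of "\<lambda>c. (_, _(i := c))"] intro!: bind_pmf_cong)
      have "expected_value G S' (rule_after ((markov \<beta>)(i := s)) h) i W x
        = measure_pmf.expectation (outcome G S \<sigma> x \<bind>
            (\<lambda>(e, \<tau>, a). map_pmf (\<lambda>c. (e, a(i := c))) (p (\<tau> i) (a i))))
          (\<lambda>(e, a). continuation G i W a x e)"
        unfolding played[symmetric] by (simp add: expected_value_def case_prod_unfold)
      also have "\<dots> = measure_pmf.expectation (outcome G S \<sigma> x) (\<lambda>(e, \<tau>, a).
          measure_pmf.expectation (p (\<tau> i) (a i)) (\<lambda>c. continuation G i W (a(i := c)) x e))"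
      proof (subst expectation_bind_pmf_finite[OF finite_outcome[OF \<sigma>]])
        fix z assume "z \<in> set_pmf (outcome G S \<sigma> x)"
        then obtain e \<tau> a where z: "z = (e, \<tau>, a)" "\<tau> i \<in> signals S i" "a i \<in> actions G i"
          using set_outcome[OF \<sigma>] by (cases z) (auto simp: profiles_def)
        have "finite (set_pmf (p (\<tau> i) (a i)))"
          using finite_subset[OF p[OF z(2,3)]] G by (auto simp: is_basic_game_def)
        then show "finite (set_pmf (case z of (e, \<tau>, a) \<Rightarrow> map_pmf (\<lambda>c. (e, a(i := c))) (p (\<tau> i) (a i))))"
          by (simp add: z)
      qed (simp add: case_prod_unfold)
      also have "\<dots> \<le> W x"
        unfolding W_def using p by (rule obedient_deviation_le[OF mce])
      finally show ?thesis .
    qed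
    \<comment> \<open>The one-period bound holds after every history, so it bounds arbitrary
      history-dependent deviations.\<close>
    then have "discounted_payoff G S' ((markov \<beta>)(i := s)) i x0 \<le> W x0"
      by (intro S'.discounted_payoff_le strategies)
    ultimately show "discounted_payoff G S' ((markov \<beta>)(i := s)) i x0 \<le> discounted_payoff G S' (markov \<beta>) i x0"
      by simp
  qed
  ultimately show ?thesis using exp by blast
qed

theorem theorem1:
  fixes G :: "('i::finite, 'a, 'x::finite, 'e::finite) basic_game"
    and S :: "('i, 't, 'x, 'e) info_structure"
  assumes "is_basic_game G" and "is_info_structure S"
  shows "MCE_predictions G S =
    (\<Union>S' \<in> {S' :: ('i, 't \<times> 's::infinite, 'x, 'e) info_structure. expansion S S'}.
       MPE_predictions G S S')"
proof (intro equalityI subsetI)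
  fix \<sigma> assume "\<sigma> \<in> MCE_predictions G S"
  then have mce: "is_MCE G S \<sigma>" by (simp add: MCE_predictions_def)
  then obtain S' :: "('i, 't \<times> 's, 'x, 'e) info_structure" and Q \<Lambda> \<beta>
    where *: "expansion_via S Q \<Lambda> S'" "is_MPE G S' \<beta>" "induces G S Q \<Lambda> \<beta> \<sigma>"
    using MCE_induced_by_MPE[OF assms] by blast
  then have "\<sigma> \<in> MPE_predictions G S S'" "expansion S S'"
    using mce by (auto simp: MPE_predictions_def expansion_def is_MCE_def)
  then show "\<sigma> \<in> (\<Union>S' \<in> {S' :: ('i, 't \<times> 's, 'x, 'e) info_structure. expansion S S'}.
      MPE_predictions G S S')"
    by blast
next
  fix \<sigma> assume "\<sigma> \<in> (\<Union>S' \<in> {S' :: ('i, 't \<times> 's, 'x, 'e) info_structure. expansion S S'}.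
      MPE_predictions G S S')"
  then show "\<sigma> \<in> MCE_predictions G S"
    using MPE_induces_MCE[OF assms] by (auto simp: MPE_predictions_def MCE_predictions_def)
qed

end
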